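(* Let $\mathcal{P}$ be a finite index set and $\{A_p : p\in\mathcal{P}\}$ a collection of real $n\times n$ matrices, each of which is either stable or unstable. Let $\tau,\eta>0$ and let $\sigma\in\mathcal{S}[\tau,\eta]$ be a switching signal. Then there exists a collection $\mathcal{R}=\{R_{(p,q)} : p,q\in\mathcal{P}\}$ of nonzero real $n\times n$ matrices such that the reset switched system $\dot x(t)=A_{\sigma(t)}x(t)$, $x(t_k)=R_{(\sigma(t_{k-1}),\sigma(t_k))}\,x(t_k^-)$ ($k\ge 1$) is stable.
   Context: A real matrix is called stable if all its eigenvalues have negative real part, and unstable if at least one eigenvalue has positive real part. A switching signal is a right-continuous piecewise constant function $\sigma:[0,\infty)\to\mathcal{P}$ whose set of discontinuities $\{t_k\}_{k\ge1}$ (switching times) is an increasing sequence with $t_k\uparrow\infty$; put $t_0=0$. $\mathcal{S}[\tau,\eta]$ is the set of switching signals such that for all $k\ge1$: $t_k-t_{k-1}\ge\tau$ if $A_{\sigma(t_{k-1})}$ is stable, and $t_k-t_{k-1}\le\eta$ if $A_{\sigma(t_{k-1})}$ is unstable. In the reset switched system, $\dot x=A_{\sigma(t)}x$ holds on each $[t_{k-1},t_k)$ and $x(t_k^-)=\lim_{t\to t_k^-}x(t)$. The system (for fixed $\sigma$) is stable if for every $\epsilon>0$ there is $\delta>0$ such that $\|x(0)\|<\delta$ implies $\|x(t)\|<\epsilon$ for all $t>0$ (Euclidean norm). *)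

theory Defs
  imports "HOL-Analysis.Analysis"
begin

text \<open>Eigenvalues of a real matrix are taken in the complex numbers.\<close>

definition complex_eigenvalue :: "real ^ 'n ^ 'n \<Rightarrow> complex \<Rightarrow> bool" where
  "complex_eigenvalue M l \<longleftrightarrow>
     (\<exists>v :: complex ^ 'n. v \<noteq> 0 \<and> map_matrix complex_of_real M *v v = l *s v)"

definition stable_matrix :: "real ^ 'n ^ 'n \<Rightarrow> bool" where
  "stable_matrix M \<longleftrightarrow> (\<forall>l. complex_eigenvalue M l \<longrightarrow> Re l < 0)"

definition unstable_matrix :: "real ^ 'n ^ 'n \<Rightarrow> bool" where
  "unstable_matrix M \<longleftrightarrow> (\<exists>l. complex_eigenvalue M l \<and> Re l > 0)"

text \<open>A signal is a function on the half line \<open>[0, \<infinity>)\<close> into a discrete index set; its values at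
  negative times are irrelevant.  Continuity at \<open>s\<close> therefore means being locally constant at \<open>s\<close>
  (relative to the half line).\<close>

definition discontinuities :: "(real \<Rightarrow> 'p) \<Rightarrow> real set" where
  "discontinuities \<sigma> = {s. 0 \<le> s \<and> \<not> (\<forall>\<^sub>F u in at s within {0..}. \<sigma> u = \<sigma> s)}"

definition right_continuous_signal :: "(real \<Rightarrow> 'p) \<Rightarrow> bool" where
  "right_continuous_signal \<sigma> \<longleftrightarrow> (\<forall>s\<ge>0. \<forall>\<^sub>F u in at_right s. \<sigma> u = \<sigma> s)"

text \<open>The next discontinuity after \<open>t\<^sub>k\<close> is \<open>t\<^sub>k\<^sub>+\<^sub>1\<close>.  The infimum is meaningful only when the
  discontinuities form a sequence, as required in \<open>switching_signal\<close>; the lemma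
  \<open>switching_time_eqI\<close> confirms that it then enumerates them.\<close>

primrec switching_time :: "(real \<Rightarrow> 'p) \<Rightarrow> nat \<Rightarrow> real" where
  "switching_time \<sigma> 0 = 0"
| "switching_time \<sigma> (Suc k) = Inf {s \<in> discontinuities \<sigma>. switching_time \<sigma> k < s}"

lemma switching_time_eqI:
  assumes "strict_mono t" and "t 0 = 0" and D: "discontinuities \<sigma> = t ` {1..}"
  shows "switching_time \<sigma> = t"
proof
  fix k
  show "switching_time \<sigma> k = t k"
  proof (induction k)
    case 0
    then show ?case using assms by simp
  next
    case (Suc k)
    have eq: "{s \<in> discontinuities \<sigma>. t k < s} = t ` {Suc k..}"
      unfolding D using assms(1) by (auto simp: strict_mono_less)
    have "Inf (t ` {Suc k..}) = t (Suc k)"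
      by (rule cInf_eq_minimum) (use assms(1) in \<open>auto simp: strict_mono_less_eq\<close>)
    then show ?case using Suc eq by simp
  qed
qed

definition switching_signal :: "'p set \<Rightarrow> (real \<Rightarrow> 'p) \<Rightarrow> bool" where
  "switching_signal P \<sigma> \<longleftrightarrow>
     \<sigma> ` {0..} \<subseteq> P \<and>
     right_continuous_signal \<sigma> \<and>
     strict_mono (switching_time \<sigma>) \<and>
     filterlim (switching_time \<sigma>) at_top sequentially \<and>
     discontinuities \<sigma> = switching_time \<sigma> ` {1..} \<and>
     (\<forall>k. \<sigma> constant_on {switching_time \<sigma> k<..<switching_time \<sigma> (Suc k)})"

text \<open>The class \<open>S[\<tau>, \<eta>]\<close>.\<close>

definition dwell_flee_signals ::
    "'p set \<Rightarrow> ('p \<Rightarrow> real ^ 'n ^ 'n) \<Rightarrow> real \<Rightarrow> real \<Rightarrow> (real \<Rightarrow> 'p) set" where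
  "dwell_flee_signals P A \<tau> \<eta> =
     {\<sigma>. switching_signal P \<sigma> \<and>
       (\<forall>k\<ge>1.
         (stable_matrix (A (\<sigma> (switching_time \<sigma> (k - 1)))) \<longrightarrow>
            switching_time \<sigma> k - switching_time \<sigma> (k - 1) \<ge> \<tau>) \<and>
         (unstable_matrix (A (\<sigma> (switching_time \<sigma> (k - 1)))) \<longrightarrow>
            switching_time \<sigma> k - switching_time \<sigma> (k - 1) \<le> \<eta>))}"

text \<open>The derivative at the left end point of each interval is the one-sided one.\<close>

definition reset_trajectory ::
    "('p \<Rightarrow> real ^ 'n ^ 'n) \<Rightarrow> ('p \<times> 'p \<Rightarrow> real ^ 'n ^ 'n) \<Rightarrow> (real \<Rightarrow> 'p) \<Rightarrow>
     (real \<Rightarrow> real ^ 'n) \<Rightarrow> bool" where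
  "reset_trajectory A R \<sigma> x \<longleftrightarrow>
     (\<forall>k\<ge>1.
       (let a = switching_time \<sigma> (k - 1); b = switching_time \<sigma> k in
         (\<forall>s\<in>{a..<b}. (x has_vector_derivative A (\<sigma> s) *v x s) (at s within {a..<b})) \<and>
         (\<exists>xm. (x \<longlongrightarrow> xm) (at_left b) \<and> x b = R (\<sigma> a, \<sigma> b) *v xm)))"

definition reset_system_stable ::
    "('p \<Rightarrow> real ^ 'n ^ 'n) \<Rightarrow> ('p \<times> 'p \<Rightarrow> real ^ 'n ^ 'n) \<Rightarrow> (real \<Rightarrow> 'p) \<Rightarrow> bool" where
  "reset_system_stable A R \<sigma> \<longleftrightarrow>
     (\<forall>\<epsilon>>0. \<exists>\<delta>>0. \<forall>x. reset_trajectory A R \<sigma> x \<longrightarrow> norm (x 0) < \<delta> \<longrightarrow> (\<forall>t>0. norm (x t) < \<epsilon>))"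

end

theory Submission
  imports Defs "HOL-Computational_Algebra.Fundamental_Theorem_Algebra"
begin

text \<open>
  It suffices to take every reset matrix equal to \<open>(1 / K) I\<close>, where \<open>K \<ge> 1\<close> bounds the
  growth of the norm along any single interval between switching times: the norm at the switching
  times is then nonincreasing. On an interval governed by an unstable matrix such a bound is
  exponential in the length, which is at most \<open>\<eta>\<close>. On one governed by a stable matrix \<open>A\<close> it must
  be uniform in the length. Let \<open>p\<close> be a nonzero complex polynomial with \<open>p(A) = 0\<close>. If \<open>z\<close> is a
  root of \<open>p = (X - z) q\<close> that is an eigenvalue, then \<open>w = (A - z) u\<close> is a solution with
  \<open>q(A) w = 0\<close>, so that \<open>w\<close> is bounded by induction on the degree, and \<open>u' = z u + w\<close> with
  \<open>Re z < 0\<close> bounds \<open>u\<close>; if \<open>z\<close> is not an eigenvalue, then \<open>q(A) u = 0\<close> already.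
\<close>

subsection \<open>Polynomials of a matrix\<close>

text \<open>This is \<open>p(M) v\<close> by Horner's rule. Evaluating at a vector avoids forming
  the matrix \<open>p(M)\<close>.\<close>

definition poly_matrix_vec :: "complex ^ 'n ^ 'n \<Rightarrow> complex poly \<Rightarrow> complex ^ 'n \<Rightarrow> complex ^ 'n" where
  "poly_matrix_vec M p v = fold_coeffs (\<lambda>c w. c *s v + M *v w) p 0"

lemma poly_matrix_vec_0 [simp]: "poly_matrix_vec M 0 v = 0"
  by (simp add: poly_matrix_vec_def)

lemma poly_matrix_vec_pCons [simp]:
  "poly_matrix_vec M (pCons c p) v = c *s v + M *v poly_matrix_vec M p v"
  by (cases "c = 0 \<and> p = 0") (auto simp: poly_matrix_vec_def)

lemma poly_matrix_vec_add:
  "poly_matrix_vec M (p + q) v = poly_matrix_vec M p v + poly_matrix_vec M q v"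
proof (induction p arbitrary: q)
  case (pCons a p)
  then show ?case
    by (cases q) (simp add: matrix_vector_right_distrib algebra_simps vector_sadd_rdistrib)
qed simp

lemma poly_matrix_vec_smult:
  "poly_matrix_vec M (smult c p) v = c *s poly_matrix_vec M p v"
  by (induction p) (auto simp: vector_ssub_ldistrib vector_add_ldistrib vector_scalar_commute
      vector_smult_assoc)

text \<open>As polynomials commute, either factor may be made to act first; the induction on the
  degree uses both orders.\<close>

lemma poly_matrix_vec_mult:
  "poly_matrix_vec M (p * q) v = poly_matrix_vec M p (poly_matrix_vec M q v)"
  by (induction p) (auto simp: poly_matrix_vec_add poly_matrix_vec_smult)

lemma poly_matrix_vec_sum:
  "poly_matrix_vec M (\<Sum>i\<in>I. p i) v = (\<Sum>i\<in>I. poly_matrix_vec M (p i) v)"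
  by (induction I rule: infinite_finite_induct) (auto simp: poly_matrix_vec_add)

lemma poly_matrix_vec_monom:
  "poly_matrix_vec M (monom c n) v = c *s (((**) M ^^ n) (mat 1) *v v)"
  by (induction n)
    (auto simp: monom_0 monom_Suc vector_scalar_commute matrix_vector_mul_assoc)

lemma matrix_annihilating_poly:
  fixes M :: "complex ^ 'n ^ 'n"
  obtains p where "p \<noteq> 0" "\<And>v. poly_matrix_vec M p v = 0"
proof -
  define pw where "pw n = ((**) M ^^ n) (mat 1)" for n
  \<comment> \<open>Linear dependence is a property of sets. Injectivity of \<open>pw\<close>
    ensures that the first \<open>?N + 1\<close> powers form a set of that size and lets the
    coefficients be indexed by exponents; a repeated power gives a relation directly.\<close>
  show thesis
  proof (cases "inj pw")
    case False
    then obtain i j where "i \<noteq> j" "pw i = pw j" by (auto simp: inj_def)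
    then have "monom 1 i - monom 1 j \<noteq> (0 :: complex poly)"
      by (metis diff_eq_diff_eq diff_self monom_eq_iff' zero_neq_one)
    moreover have "poly_matrix_vec M (monom 1 i + monom (-1) j) v = 0" for v
      using \<open>pw i = pw j\<close> by (simp add: poly_matrix_vec_add poly_matrix_vec_monom pw_def)
    ultimately show thesis using that[of "monom 1 i + monom (-1) j"]
      by (simp add: minus_monom[symmetric] del: minus_monom)
  next
    case True
    let ?N = "DIM(complex ^ 'n ^ 'n)"
    have inj: "inj_on pw {..?N}" using True by (rule inj_on_subset) auto
    then have "dependent (pw ` {..?N})"
      by (intro dependent_biggerset) (simp only: card_image card_atMost)
    then obtain f k where f: "(\<Sum>i\<le>?N. f (pw i) *\<^sub>R pw i) = 0" and k: "k \<le> ?N" "f (pw k) \<noteq> 0"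
      using real_vector.dependent_finite[of "pw ` {..?N}"] inj by (auto simp: sum.reindex)
    define p where "p = (\<Sum>i\<le>?N. monom (complex_of_real (f (pw i))) i)"
    have "coeff p k \<noteq> 0"
      using k by (simp add: p_def coeff_sum if_distrib cong: if_cong)
    then have "p \<noteq> 0" by auto
    moreover have "poly_matrix_vec M p v = 0" for v
    proof -
      have "poly_matrix_vec M p v = (\<Sum>i\<le>?N. (f (pw i) *\<^sub>R pw i) *v v)"
        unfolding p_def poly_matrix_vec_sum poly_matrix_vec_monom pw_def[symmetric]
        by (intro sum.cong) (auto simp: vec_eq_iff matrix_vector_mult_def sum_distrib_left
              scaleR_conv_of_real[where 'a = complex] mult.assoc)
      also have "\<dots> = (\<Sum>i\<le>?N. f (pw i) *\<^sub>R pw i) *v v"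
        by (auto simp: matrix_vector_mult_def vec_eq_iff sum_distrib_right intro: sum.swap)
      finally show ?thesis using f by simp
    qed
    ultimately show thesis by (rule that)
  qed
qed

subsection \<open>Bounds for linear differential equations\<close>

lemma norm_vector_scalar_mult: "norm (c *s (v :: complex ^ 'n)) = norm c * norm v"
  by (simp add: norm_vec_def norm_mult L2_set_right_distrib)

lemma bounded_bilinear_vector_scalar_mult:
  "bounded_bilinear (\<lambda>c (v :: complex ^ 'n). c *s v)"
proof
  show "\<exists>K. \<forall>a (b :: complex ^ 'n). norm (a *s b) \<le> norm a * norm b * K"
    by (rule exI[of _ 1]) (simp add: norm_vector_scalar_mult)
qed (auto simp: vec_eq_iff algebra_simps)

lemma bounded_linear_matrix_vector_mult_complex: "bounded_linear ((*v) (M :: complex ^ 'm ^ 'n))"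
  by (intro linear_conv_bounded_linear[THEN iffD1] linearI)
    (auto simp: vec_eq_iff matrix_vector_mult_def algebra_simps sum.distrib scaleR_sum_right)

text \<open>Variation of constants: \<open>exp (- l (s - a)) u(s)\<close> has derivative \<open>exp (- l (s - a)) w(s)\<close>.\<close>

lemma norm_bound_inhomogeneous_scalar_ode:
  fixes u w :: "real \<Rightarrow> complex ^ 'n"
  assumes l: "Re l < 0"
    and u: "\<And>s. s \<in> {a..<b} \<Longrightarrow> (u has_vector_derivative l *s u s + w s) (at s within {a..<b})"
    and w: "\<And>s. s \<in> {a..<b} \<Longrightarrow> norm (w s) \<le> B"
    and t: "t \<in> {a..<b}"
  shows "norm (u t) \<le> norm (u a) + B / - Re l"
proof (cases "a = t")
  \<comment> \<open>The mean value inequality used in the other case needs \<open>a < t\<close>.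
    Here it is enough that \<open>B \<ge> 0\<close>, which the bound on \<open>w t\<close>
    yields.\<close>
  case True
  then show ?thesis using w[OF t] l norm_ge_zero[of "w t"] by (simp add: field_simps del: norm_ge_zero)
next
  case False
  with t have t: "a < t" "t < b" by auto
  define r where "r = - Re l"
  have r: "r > 0" using l by (simp add: r_def)
  define e where "e s = exp (- (l * (complex_of_real s - of_real a)))" for s
  \<comment> \<open>An antiderivative of \<open>exp (r * (s - a)) * B\<close>, which dominates the
    norm of the derivative of \<open>e s *s u s\<close>.\<close>
  define \<phi> where "\<phi> s = exp (r * (s - a)) * (B / r)" for s
  have e: "(e has_vector_derivative - l * e s) (at s within S)" for s S
    unfolding e_def
    by (rule has_vector_derivative_real_field) (auto intro!: derivative_eq_intros)
  have norm_e: "norm (e s) = exp (r * (s - a))" for s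
    by (simp add: e_def r_def algebra_simps)
  have v: "((\<lambda>s. e s *s u s) has_vector_derivative e s *s w s) (at s within {a..<b})"
    if "s \<in> {a..<b}" for s
  proof -
    have "((\<lambda>s. e s *s u s) has_vector_derivative
        e s *s (l *s u s + w s) + (- l * e s) *s u s) (at s within {a..<b})"
      by (intro bounded_bilinear.has_vector_derivative[OF bounded_bilinear_vector_scalar_mult] e u that)
    moreover have "e s *s (l *s u s + w s) + (- l * e s) *s u s = e s *s w s"
      by (simp add: vec_eq_iff algebra_simps)
    ultimately show ?thesis by (simp only:)
  qed
  have "norm (e t *s u t - e a *s u a) \<le> \<phi> t - \<phi> a"
  proof (rule differentiable_bound_general[OF t(1)])
    have "continuous_on {a..<b} (\<lambda>s. e s *s u s)"
      using v has_vector_derivative_continuous continuous_on_eq_continuous_within by blast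
    then show "continuous_on {a..t} (\<lambda>s. e s *s u s)"
      by (rule continuous_on_subset) (use t in auto)
    show "continuous_on {a..t} \<phi>"
      unfolding \<phi>_def by (intro continuous_intros)
    fix s assume s: "a < s" "s < t"
    then have "at s within {a..<b} = at s"
      by (intro at_within_interior) (use t in auto)
    then show "((\<lambda>s. e s *s u s) has_vector_derivative e s *s w s) (at s)"
      using v[of s] s t by auto
    show "(\<phi> has_vector_derivative exp (r * (s - a)) * B) (at s)"
      unfolding \<phi>_def has_real_derivative_iff_has_vector_derivative[symmetric]
      using r by (auto intro!: derivative_eq_intros)
    show "norm (e s *s w s) \<le> exp (r * (s - a)) * B"
      unfolding norm_vector_scalar_mult norm_e using w[of s] s t by auto
  qed
  moreover have "norm (e t *s u t) \<le> norm (e t *s u t - e a *s u a) + norm (e a *s u a)"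
    by norm
  ultimately have "exp (r * (t - a)) * norm (u t) \<le> exp (r * (t - a)) * (B / r) - B / r + norm (u a)"
    by (simp add: norm_vector_scalar_mult norm_e \<phi>_def)
  \<comment> \<open>The term \<open>- B / r\<close> is dropped and \<open>norm (u a)\<close>
    acquires the factor \<open>exp (r * (t - a)) \<ge> 1\<close>, so that this factor cancels on
    both sides.\<close>
  also have "\<dots> \<le> exp (r * (t - a)) * (B / r) + exp (r * (t - a)) * norm (u a)"
  proof -
    have "0 \<le> B" using w[of a] norm_ge_zero[of "w a"] t by (simp del: norm_ge_zero)
    then have "0 \<le> B / r" using r by simp
    moreover have "1 * norm (u a) \<le> exp (r * (t - a)) * norm (u a)"
      using r t by (intro mult_right_mono) auto
    ultimately show ?thesis by linarith
  qed
  finally have "exp (r * (t - a)) * norm (u t) \<le> exp (r * (t - a)) * (norm (u a) + B / r)"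
    by (simp add: algebra_simps)
  then show ?thesis by (simp add: r_def)
qed

text \<open>\<open>K\<close> is chosen before \<open>a\<close>, \<open>b\<close> and
  \<open>u\<close>, so it is uniform in the length of the interval. Annihilation is demanded only
  along the solution, so that the induction hypothesis applies to \<open>N (u s)\<close> with the
  cofactor \<open>q\<close>.\<close>

lemma linear_ode_bounded_complex:
  fixes M :: "complex ^ 'n ^ 'n"
  assumes ev: "\<forall>z v. v \<noteq> 0 \<longrightarrow> M *v v = z *s v \<longrightarrow> Re z < 0"
    and "p \<noteq> 0"
  shows "\<exists>K\<ge>0. \<forall>a b u.
      (\<forall>s\<in>{a..<b}. (u has_vector_derivative M *v u s) (at s within {a..<b})) \<longrightarrow>
      (\<forall>s\<in>{a..<b}. poly_matrix_vec M p (u s) = 0) \<longrightarrow>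
      (\<forall>s\<in>{a..<b}. norm (u s) \<le> K * norm (u a))"
  using \<open>p \<noteq> 0\<close>
proof (induction "degree p" arbitrary: p)
  case 0
  then obtain c where "p = [:c:]" "c \<noteq> 0"
    by (metis degree_eq_zeroE pCons_0_0)
  \<comment> \<open>A nonzero constant annihilates \<open>u s\<close> only if
    \<open>u s = 0\<close>.\<close>
  then show ?case by (intro exI[of _ 0]) auto
next
  case (Suc d)
  then have "\<not> constant (poly p)" by (simp add: constant_degree)
  then obtain z where "poly p z = 0" using fundamental_theorem_of_algebra by blast
  then obtain q where q: "p = [:- z, 1:] * q" by (meson dvdE poly_eq_0_iff_dvd)
  with Suc.prems have "q \<noteq> 0" by auto
  then have "degree p = Suc (degree q)" unfolding q by (subst degree_mult_eq) auto
  with Suc.hyps(2) have "d = degree q" by simp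
  from Suc.hyps(1)[OF this \<open>q \<noteq> 0\<close>] obtain K where K: "K \<ge> 0"
    and bound: "\<And>a b u s.
      (\<forall>s\<in>{a..<b}. (u has_vector_derivative M *v u s) (at s within {a..<b})) \<Longrightarrow>
      (\<forall>s\<in>{a..<b}. poly_matrix_vec M q (u s) = 0) \<Longrightarrow> s \<in> {a..<b} \<Longrightarrow>
      norm (u s) \<le> K * norm (u a)"
    by blast
  define N where "N v = poly_matrix_vec M [:- z, 1:] v" for v
  have N_eq: "N v = M *v v - z *s v" for v by (simp add: N_def vec_eq_iff)
  \<comment> \<open>With this order, \<open>q\<close> annihilates \<open>N (u s)\<close>. With the
    opposite order below, \<open>q\<close> annihilates \<open>u s\<close> itself once
    \<open>N\<close> has trivial kernel.\<close>
  have p_qN: "poly_matrix_vec M p v = poly_matrix_vec M q (N v)" for v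
    unfolding q N_def mult.commute[of "[:- z, 1:]"] by (rule poly_matrix_vec_mult)
  have p_Nq: "poly_matrix_vec M p v = N (poly_matrix_vec M q v)" for v
    unfolding q N_def by (rule poly_matrix_vec_mult)
  show ?case
  proof (cases "\<exists>v. v \<noteq> 0 \<and> M *v v = z *s v")
    case False
    then have "N v = 0 \<Longrightarrow> v = 0" for v by (auto simp: N_eq)
    then show ?thesis using K bound p_Nq by (metis (no_types, lifting))
  next
    case True
    then have z: "Re z < 0" using ev by blast
    have blN: "bounded_linear N"
      unfolding N_eq using bounded_linear_matrix_vector_mult_complex
        bounded_bilinear.bounded_linear_right[OF bounded_bilinear_vector_scalar_mult]
      by (rule bounded_linear_sub)
    then obtain C where C: "C > 0" "\<And>v. norm (N v) \<le> norm v * C"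
      using bounded_linear.pos_bounded by blast
    \<comment> \<open>The constant comes from the inhomogeneous bound with
      \<open>B = K * norm (N (u a))\<close>, where \<open>C\<close> bounds the operator norm of
      \<open>N\<close>.\<close>
    have "norm (u s) \<le> (1 + K * C / - Re z) * norm (u a)"
      if u: "\<forall>s\<in>{a..<b}. (u has_vector_derivative M *v u s) (at s within {a..<b})"
        and ann: "\<forall>s\<in>{a..<b}. poly_matrix_vec M p (u s) = 0" and s: "s \<in> {a..<b}" for a b u s
    proof -
      have w: "norm (N (u s)) \<le> K * norm (N (u a))" if "s \<in> {a..<b}" for s
      proof (rule bound[where u = "\<lambda>s. N (u s)"])
        show "\<forall>s\<in>{a..<b}. ((\<lambda>s. N (u s)) has_vector_derivative M *v N (u s)) (at s within {a..<b})"
        proof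
          fix s assume "s \<in> {a..<b}"
          then have "((\<lambda>s. N (u s)) has_vector_derivative N (M *v u s)) (at s within {a..<b})"
            using u by (intro bounded_linear.has_vector_derivative[OF blN]) auto
          \<comment> \<open>\<open>N\<close> commutes with \<open>M\<close>, so it maps solutions to
            solutions.\<close>
          moreover have "N (M *v u s) = M *v N (u s)"
            by (simp add: N_eq matrix_vector_mult_diff_distrib vector_scalar_commute)
          ultimately show "((\<lambda>s. N (u s)) has_vector_derivative M *v N (u s)) (at s within {a..<b})"
            by simp
        qed
      qed (use ann p_qN that in auto)
      have "norm (u s) \<le> norm (u a) + K * norm (N (u a)) / - Re z"
        by (rule norm_bound_inhomogeneous_scalar_ode[OF z _ w s]) (use u in \<open>auto simp: N_eq\<close>)
      also have "\<dots> \<le> norm (u a) + K * (norm (u a) * C) / - Re z"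
        by (intro add_left_mono divide_right_mono mult_left_mono C K) (use z in auto)
      also have "\<dots> = (1 + K * C / - Re z) * norm (u a)"
        by (simp add: algebra_simps)
      finally show ?thesis .
    qed
    moreover have "0 \<le> 1 + K * C / - Re z"
      using K C z by (intro add_nonneg_nonneg divide_nonneg_pos) auto
    ultimately show ?thesis by blast
  qed
qed

text \<open>Complexification: \<open>c\<close> is a real-linear isometry that intertwines
  \<open>A\<close> with \<open>M\<close>, so it carries real solutions to complex ones of the same
  norm.\<close>

lemma stable_linear_ode_bounded:
  fixes A :: "real ^ 'n ^ 'n"
  assumes "stable_matrix A"
  obtains K where "\<And>a b x s.
      (\<forall>s\<in>{a..<b}. (x has_vector_derivative A *v x s) (at s within {a..<b})) \<Longrightarrow>
      s \<in> {a..<b} \<Longrightarrow> norm (x s) \<le> K * norm (x a)"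
proof -
  define M where "M = map_matrix complex_of_real A"
  define c where "c v = (\<chi> i. complex_of_real (v $ i))" for v :: "real ^ 'n"
  have norm_c: "norm (c v) = norm v" for v
    by (simp add: c_def norm_vec_def)
  have blc: "bounded_linear c"
    by (intro linear_conv_bounded_linear[THEN iffD1] linearI)
      (auto simp: c_def vec_eq_iff scaleR_conv_of_real[where 'a = complex])
  have c_mult: "c (A *v v) = M *v c v" for v
    by (simp add: c_def M_def vec_eq_iff matrix_vector_mult_def map_matrix_def)
  have ev: "\<forall>z v. v \<noteq> 0 \<longrightarrow> M *v v = z *s v \<longrightarrow> Re z < 0"
    using assms by (auto simp: stable_matrix_def complex_eigenvalue_def M_def)
  obtain p where p: "p \<noteq> 0" "\<And>v. poly_matrix_vec M p v = 0"
    using matrix_annihilating_poly by blast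
  obtain K where K: "\<And>a b u s.
      (\<forall>s\<in>{a..<b}. (u has_vector_derivative M *v u s) (at s within {a..<b})) \<Longrightarrow>
      s \<in> {a..<b} \<Longrightarrow> norm (u s) \<le> K * norm (u a)"
    using linear_ode_bounded_complex[OF ev p(1)] p(2) by blast
  show thesis
  proof
    fix a b x s
    assume x: "\<forall>s\<in>{a..<b}. (x has_vector_derivative A *v x s) (at s within {a..<b})"
      and s: "s \<in> {a..<b}"
    have "norm (c (x s)) \<le> K * norm (c (x a))"
      by (rule K[of a b "\<lambda>s. c (x s)"])
        (use x s in \<open>auto intro!: bounded_linear.has_vector_derivative[OF blc] simp: c_mult[symmetric]\<close>)
    then show "norm (x s) \<le> K * norm (x a)" by (simp add: norm_c)
  qed
qed

text \<open>A Gronwall estimate for the energy \<open>x \<bullet> x\<close>, whose derivative is at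
  most \<open>2 * L\<close> times itself by Cauchy-Schwarz.\<close>

lemma linear_ode_growth:
  fixes A :: "real ^ 'n ^ 'n"
  obtains L where "L > 0" "\<And>a b x t.
      (\<forall>s\<in>{a..<b}. (x has_vector_derivative A *v x s) (at s within {a..<b})) \<Longrightarrow>
      t \<in> {a..<b} \<Longrightarrow> norm (x t) \<le> exp (L * (t - a)) * norm (x a)"
proof -
  obtain L where L: "L > 0" "\<And>v. norm (A *v v) \<le> norm v * L"
    using bounded_linear.pos_bounded[OF matrix_vector_mul_bounded_linear] by blast
  show thesis
  proof
    fix a b x t
    assume x: "\<forall>s\<in>{a..<b}. (x has_vector_derivative A *v x s) (at s within {a..<b})"
      and t: "t \<in> {a..<b}"
    \<comment> \<open>The squared norm is used because it stays differentiable where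
      \<open>x\<close> vanishes; hence the factor 2 in the exponent.\<close>
    define f where "f s = exp (- 2 * L * (s - a)) * (x s \<bullet> x s)" for s
    have "f t \<le> f a"
    proof (rule DERIV_nonpos_imp_decreasing_open[where f = f and a = a and b = t])
      show "a \<le> t" using t by simp
      have "continuous_on {a..<b} x"
        using x has_vector_derivative_continuous continuous_on_eq_continuous_within by blast
      then have "continuous_on {a..t} x"
        by (rule continuous_on_subset) (use t in auto)
      then show "continuous_on {a..t} f"
        unfolding f_def by (intro continuous_intros)
      fix s assume s: "a < s" "s < t"
      then have "at s within {a..<b} = at s"
        by (intro at_within_interior) (use t in auto)
      then have xs: "(x has_vector_derivative A *v x s) (at s)"
        using x[rule_format, of s] s t by auto
      have "((\<lambda>s. x s \<bullet> x s) has_real_derivative x s \<bullet> (A *v x s) + (A *v x s) \<bullet> x s) (at s)"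
        unfolding has_real_derivative_iff_has_vector_derivative
        by (intro bounded_bilinear.has_vector_derivative[OF bounded_bilinear_inner] xs)
      then have "(f has_real_derivative
          exp (- 2 * L * (s - a)) * (2 * (x s \<bullet> (A *v x s)) - 2 * L * (x s \<bullet> x s))) (at s)"
        unfolding f_def
        by (auto intro!: derivative_eq_intros simp: inner_commute algebra_simps)
      moreover have "exp (- 2 * L * (s - a)) * (2 * (x s \<bullet> (A *v x s)) - 2 * L * (x s \<bullet> x s)) \<le> 0"
      proof (rule mult_nonneg_nonpos)
        have "x s \<bullet> (A *v x s) \<le> norm (x s) * norm (A *v x s)" by (rule norm_cauchy_schwarz)
        also have "\<dots> \<le> norm (x s) * (norm (x s) * L)" by (intro mult_left_mono L) auto
        also have "\<dots> = L * (x s \<bullet> x s)" by (simp add: dot_square_norm power2_eq_square)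
        finally show "2 * (x s \<bullet> (A *v x s)) - 2 * L * (x s \<bullet> x s) \<le> 0" by simp
      qed simp
      ultimately show "\<exists>y. (f has_real_derivative y) (at s) \<and> y \<le> 0" by blast
    qed
    then have "(norm (x t))\<^sup>2 / exp (2 * L * (t - a)) \<le> (norm (x a))\<^sup>2"
      by (simp add: f_def dot_square_norm exp_minus divide_inverse mult.commute)
    then have "(norm (x t))\<^sup>2 \<le> exp (2 * L * (t - a)) * (norm (x a))\<^sup>2"
      by (simp only: pos_divide_le_eq exp_gt_zero mult.commute)
    also have "\<dots> = (exp (L * (t - a)) * norm (x a))\<^sup>2"
      by (simp add: power_mult_distrib exp_double[symmetric] mult.assoc)
    finally show "norm (x t) \<le> exp (L * (t - a)) * norm (x a)"
      by (rule power2_le_imp_le) simp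
  qed (rule L)
qed

text \<open>Merges both cases, so that a single constant can be chosen for each index; the length is
  restricted only in the unstable case.\<close>

lemma linear_ode_bounded_dwell_flee:
  fixes A :: "real ^ 'n ^ 'n"
  assumes "stable_matrix A \<or> unstable_matrix A"
  shows "\<exists>K. \<forall>a b x s.
      (unstable_matrix A \<longrightarrow> b - a \<le> \<eta>) \<longrightarrow>
      (\<forall>s\<in>{a..<b}. (x has_vector_derivative A *v x s) (at s within {a..<b})) \<longrightarrow>
      s \<in> {a..<b} \<longrightarrow> norm (x s) \<le> K * norm (x a)"
  using assms
proof
  assume "stable_matrix A"
  then show ?thesis by (rule stable_linear_ode_bounded) blast
next
  assume A: "unstable_matrix A"
  obtain L where L: "L > 0" "\<And>a b x t.
      (\<forall>s\<in>{a..<b}. (x has_vector_derivative A *v x s) (at s within {a..<b})) \<Longrightarrow>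
      t \<in> {a..<b} \<Longrightarrow> norm (x t) \<le> exp (L * (t - a)) * norm (x a)"
    using linear_ode_growth[of A] by blast
  have "norm (x s) \<le> exp (L * \<eta>) * norm (x a)"
    if "b - a \<le> \<eta>" "\<forall>s\<in>{a..<b}. (x has_vector_derivative A *v x s) (at s within {a..<b})"
      "s \<in> {a..<b}" for a b x s
  proof -
    have "norm (x s) \<le> exp (L * (s - a)) * norm (x a)" by (rule L(2)[OF that(2,3)])
    also have "\<dots> \<le> exp (L * \<eta>) * norm (x a)"
      using that(1,3) L(1) by (intro mult_right_mono) auto
    finally show ?thesis .
  qed
  with A show ?thesis by blast
qed

subsection \<open>Reset systems\<close>

text \<open>Right continuity extends constancy from the open interval to its left end. The
  differential equation there thus has a fixed matrix.\<close>

lemma switching_signal_eq_left_end: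
  assumes "switching_signal P \<sigma>"
    and s: "s \<in> {switching_time \<sigma> k..<switching_time \<sigma> (Suc k)}"
  shows "\<sigma> s = \<sigma> (switching_time \<sigma> k)"
proof -
  let ?a = "switching_time \<sigma> k" and ?b = "switching_time \<sigma> (Suc k)"
  have "strict_mono (switching_time \<sigma>)" and rc: "right_continuous_signal \<sigma>"
    and "\<sigma> constant_on {?a<..<?b}"
    using assms(1) by (auto simp: switching_signal_def)
  then obtain c where c: "\<And>u. u \<in> {?a<..<?b} \<Longrightarrow> \<sigma> u = c" by (auto simp: constant_on_def)
  have "switching_time \<sigma> 0 \<le> ?a"
    using strict_mono_less_eq[OF \<open>strict_mono (switching_time \<sigma>)\<close>, of 0 k] by (simp only: le0)
  then have "\<forall>\<^sub>F u in at_right ?a. \<sigma> u = \<sigma> ?a"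
    using rc by (simp add: right_continuous_signal_def)
  moreover have "\<forall>\<^sub>F u in at_right ?a. u \<in> {?a<..<?b}"
    using s by (intro eventually_at_right_real) auto
  ultimately have "\<forall>\<^sub>F u in at_right ?a. c = \<sigma> ?a"
    by eventually_elim (simp add: c)
  \<comment> \<open>The filter \<open>at_right ?a\<close> is nontrivial, so an eventual statement
    free of \<open>u\<close> is true.\<close>
  then have "c = \<sigma> ?a" by simp
  then show ?thesis using c s by (cases "s = ?a") auto
qed

text \<open>Switching times tend to infinity, so some least one exceeds \<open>t\<close>; its index
  is positive because time 0 does not exceed \<open>t\<close>.\<close>

lemma switching_time_interval:
  assumes "switching_signal P \<sigma>" and "t \<ge> 0"
  obtains k where "t \<in> {switching_time \<sigma> k..<switching_time \<sigma> (Suc k)}"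
proof -
  have "filterlim (switching_time \<sigma>) at_top sequentially"
    using assms(1) by (simp add: switching_signal_def)
  then have ex: "\<exists>n. t < switching_time \<sigma> n"
    by (metis eventually_sequentially filterlim_at_top_dense order_refl)
  define n where "n = (LEAST n. t < switching_time \<sigma> n)"
  have n: "t < switching_time \<sigma> n" unfolding n_def using ex by (rule LeastI_ex)
  with assms(2) obtain k where k: "n = Suc k" by (cases n) auto
  then have "\<not> t < switching_time \<sigma> k" unfolding n_def by (metis lessI not_less_Least)
  with n k show thesis by (intro that[of k]) auto
qed

theorem theorem3p2:
  fixes P :: "'p set"
    and A :: "'p \<Rightarrow> real ^ 'n ^ 'n"
    and \<tau> \<eta> :: real
    and \<sigma> :: "real \<Rightarrow> 'p"
  assumes "finite P"
    and "\<forall>p\<in>P. stable_matrix (A p) \<or> unstable_matrix (A p)"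
    and "\<tau> > 0" and "\<eta> > 0"
    and "\<sigma> \<in> dwell_flee_signals P A \<tau> \<eta>"
  shows "\<exists>R :: 'p \<times> 'p \<Rightarrow> real ^ 'n ^ 'n.
           (\<forall>p\<in>P. \<forall>q\<in>P. R (p, q) \<noteq> 0) \<and> reset_system_stable A R \<sigma>"
proof -
  let ?t = "switching_time \<sigma>"
  \<comment> \<open>The definitions index an interval by its right end, \<open>k \<ge> 1\<close>;
    from here on the index is that of the left end.\<close>
  have sw: "switching_signal P \<sigma>"
    and flee: "\<And>k. unstable_matrix (A (\<sigma> (?t k))) \<Longrightarrow> ?t (Suc k) - ?t k \<le> \<eta>"
    using assms(5) by (force simp: dwell_flee_signals_def)+
  have mono: "strict_mono ?t" using sw by (simp add: switching_signal_def)
  have t_nonneg: "0 \<le> ?t k" for k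
    using mono by (metis le0 strict_mono_less_eq switching_time.simps(1))
  have \<sigma>_in: "\<sigma> (?t k) \<in> P" for k
    using sw t_nonneg[of k] by (auto simp: switching_signal_def)
  obtain K where K: "\<And>p a b x s. p \<in> P \<Longrightarrow> (unstable_matrix (A p) \<Longrightarrow> b - a \<le> \<eta>) \<Longrightarrow>
      (\<forall>s\<in>{a..<b}. (x has_vector_derivative A p *v x s) (at s within {a..<b})) \<Longrightarrow>
      s \<in> {a..<b} \<Longrightarrow> norm (x s) \<le> K p * norm (x a)"
  proof -
    have "\<forall>p\<in>P. \<exists>K. \<forall>a b x s.
        (unstable_matrix (A p) \<longrightarrow> b - a \<le> \<eta>) \<longrightarrow>
        (\<forall>s\<in>{a..<b}. (x has_vector_derivative A p *v x s) (at s within {a..<b})) \<longrightarrow>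
        s \<in> {a..<b} \<longrightarrow> norm (x s) \<le> K * norm (x a)"
      by (intro ballI linear_ode_bounded_dwell_flee) (use assms(2) in blast)
    from bchoice[OF this] show thesis using that by blast
  qed
  \<comment> \<open>Finiteness of \<open>P\<close> makes the sum a common bound for all
    \<open>K p\<close>; the summand 1 keeps \<open>c\<close> positive, so that dividing by it is
    harmless.\<close>
  define c where "c = 1 + (\<Sum>p\<in>P. \<bar>K p\<bar>)"
  have c: "c \<ge> 1" by (simp add: c_def sum_nonneg)
  have K_le: "K p \<le> c" if "p \<in> P" for p
    using member_le_sum[of p P "\<lambda>p. \<bar>K p\<bar>"] that assms(1) by (simp add: c_def)
  define R :: "'p \<times> 'p \<Rightarrow> real ^ 'n ^ 'n" where "R = (\<lambda>_. (1 / c) *\<^sub>R mat 1)"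
  have "mat 1 \<noteq> (0 :: real ^ 'n ^ 'n)"
    by (simp add: vec_eq_iff mat_def)
  then have R_nz: "R pq \<noteq> 0" for pq
    using c by (simp add: R_def)
  have norm_R: "norm (R pq *v v) = norm v / c" for pq v
    using c by (simp add: R_def scaleR_matrix_vector_assoc[symmetric])
  have bound: "norm (x t) \<le> c * norm (x 0)" if x: "reset_trajectory A R \<sigma> x" and "t \<ge> 0" for x t
  proof -
    have step: "norm (x s) \<le> c * norm (x (?t k))" if s: "s \<in> {?t k..<?t (Suc k)}" for k s
    proof -
      have "(x has_vector_derivative A (\<sigma> (?t k)) *v x s) (at s within {?t k..<?t (Suc k)})"
        if "s \<in> {?t k..<?t (Suc k)}" for s
        using x[unfolded reset_trajectory_def, rule_format, of "Suc k"] that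
          switching_signal_eq_left_end[OF sw that]
        by (metis (no_types, lifting) One_nat_def Suc_le_mono diff_Suc_1 le0)
      then have "norm (x s) \<le> K (\<sigma> (?t k)) * norm (x (?t k))"
        using K[OF \<sigma>_in flee _ s] by blast
      also have "\<dots> \<le> c * norm (x (?t k))"
        by (intro mult_right_mono K_le \<sigma>_in) auto
      finally show ?thesis .
    qed
    have jump: "norm (x (?t (Suc k))) \<le> norm (x (?t k))" for k
    proof -
      obtain xm where xm: "(x \<longlongrightarrow> xm) (at_left (?t (Suc k)))"
        "x (?t (Suc k)) = R (\<sigma> (?t k), \<sigma> (?t (Suc k))) *v xm"
        using x[unfolded reset_trajectory_def, rule_format, of "Suc k"]
        by (auto simp: Let_def simp del: switching_time.simps)
      have "?t k < ?t (Suc k)" using mono by (simp add: strict_mono_less del: switching_time.simps)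
      then have "\<forall>\<^sub>F s in at_left (?t (Suc k)). s \<in> {?t k<..<?t (Suc k)}"
        by (rule eventually_at_left_real)
      then have "\<forall>\<^sub>F s in at_left (?t (Suc k)). norm (x s) \<le> c * norm (x (?t k))"
        by eventually_elim (auto intro!: step)
      \<comment> \<open>The bound passes to the left limit, and the reset then divides by exactly
        the factor \<open>c\<close> gained on the interval.\<close>
      then have "norm xm \<le> c * norm (x (?t k))"
        by (intro tendsto_upperbound[OF tendsto_norm[OF xm(1)]]) auto
      then show ?thesis using c by (simp add: xm(2) norm_R field_simps del: switching_time.simps)
    qed
    \<comment> \<open>Growth on completed intervals has been cancelled by resets, so at time
      \<open>t\<close> only the factor \<open>c\<close> of the current interval remains.\<close>
    have "norm (x (?t k)) \<le> norm (x 0)" for k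
    proof (induction k)
      case (Suc k)
      then show ?case using jump[of k] by (rule order_trans[rotated])
    qed simp
    moreover obtain k where "t \<in> {?t k..<?t (Suc k)}"
      using switching_time_interval[OF sw \<open>t \<ge> 0\<close>] .
    ultimately show ?thesis
      using step[of t k] c by (meson mult_left_mono order_trans zero_le_one)
  qed
  have "reset_system_stable A R \<sigma>"
    unfolding reset_system_stable_def
  proof (intro allI impI)
    fix \<epsilon> :: real assume \<epsilon>: "\<epsilon> > 0"
    have "norm (x t) < \<epsilon>" if "reset_trajectory A R \<sigma> x" "norm (x 0) < \<epsilon> / c" "t > 0" for x t
    proof -
      have "norm (x t) \<le> c * norm (x 0)" using that by (intro bound) auto
      also have "\<dots> < \<epsilon>" using that(2) c by (simp add: field_simps)
      finally show ?thesis .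
    qed
    moreover have "\<epsilon> / c > 0" using \<epsilon> c by simp
    ultimately show "\<exists>\<delta>>0. \<forall>x. reset_trajectory A R \<sigma> x \<longrightarrow> norm (x 0) < \<delta> \<longrightarrow> (\<forall>t>0. norm (x t) < \<epsilon>)"
      by blast
  qed
  with R_nz show ?thesis by blast
qed

end
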